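(* Let $A\in\mathbb{R}^{n\times n}$ be symmetric and let $$A Q_m = Q_m T_m + q_{i+1} b_m^{\mathsf T} + F_m,\qquad Q_{m+1}^{\mathsf T}F_m = 0,\qquad Q_{m+1}:=[Q_m,\,q_{i+1}],$$ be a Krylov-like decomposition. Let $V_\ell\in\mathbb{R}^{m\times\ell}$, with $\ell<m$, be an orthonormal matrix, and set $\widetilde Q_\ell=Q_mV_\ell$, $\widetilde q_{\ell+1}=q_{i+1}$, $\widetilde Q_{\ell+1}=[\widetilde Q_\ell,\,q_{i+1}]$. Let $$q_{i+2}:=\beta_{i+1}^{-1}(I-Q_{m+1}Q_{m+1}^{\mathsf T})Aq_{i+1},\qquad \widetilde q_{\ell+2}:=\widetilde\beta_{\ell+1}^{-1}(I-\widetilde Q_{\ell+1}\widetilde Q_{\ell+1}^{\mathsf T})A\widetilde q_{\ell+1}$$ be the next Lanczos vectors without and with compression, where $\beta_{i+1},\widetilde\beta_{\ell+1}\in\mathbb{R}$ are normalization factors such that $\|q_{i+2}\|=\|\widetilde q_{\ell+2}\|=1$. Assume that $V_\ell V_\ell^{\mathsf T}b_m=b_m$. Then, up to a sign change, $\widetilde\beta_{\ell+1}=\beta_{i+1}$ and $\widetilde q_{\ell+2}=q_{i+2}$; that is, there is $\sigma\in\{1,-1\}$ with $\widetilde\beta_{\ell+1}=\sigma\beta_{i+1}$ and $\widetilde q_{\ell+2}=\sigma q_{i+2}$.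
   Context: A matrix $Q$ is called orthonormal if its columns are orthonormal, i.e. $Q^{\mathsf T}Q=I$; $\|\cdot\|$ is the Euclidean norm. Krylov-like decomposition of a symmetric matrix $A\in\mathbb{R}^{n\times n}$: matrices $Q_m\in\mathbb{R}^{n\times m}$, $T_m\in\mathbb{R}^{m\times m}$, $F_m\in\mathbb{R}^{n\times m}$ and vectors $q_{i+1}\in\mathbb{R}^n$, $b_m\in\mathbb{R}^m$ such that $AQ_m=Q_mT_m+q_{i+1}b_m^{\mathsf T}+F_m$ and $Q_{m+1}^{\mathsf T}F_m=0$, where $Q_{m+1}=[Q_m,q_{i+1}]$ has orthonormal columns, $T_m$ is symmetric (not necessarily tridiagonal), and $b_m$ is a general vector. The vector $q_{i+1}$, with $i\ge m$, is a vector from the Lanczos process for $A$, i.e. from the sequence generated from a unit vector $q_1$ by $q_{j+1}=\beta_j^{-1}(Aq_j-\alpha_jq_j-\beta_{j-1}q_{j-1})$ with $\alpha_j=q_j^{\mathsf T}Aq_j$, $\beta_0q_0=0$, and $\beta_j\neq0$ normalizing $q_{j+1}$ to norm one. Standing assumption: no breakdown occurs, so the vectors being normalized are nonzero and the normalization factors are nonzero. *)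

theory Defs
  imports Complex_Main "Jordan_Normal_Form.Matrix"
begin

definition euclid_norm :: "real vec \<Rightarrow> real" where
  "euclid_norm v = sqrt (v \<bullet> v)"

definition symmetric_mat :: "real mat \<Rightarrow> bool" where
  "symmetric_mat A \<longleftrightarrow> square_mat A \<and> transpose_mat A = A"

(* The library's orthogonal_mat is a different notion: it only asks for pairwise
   orthogonal nonzero columns, without normalization. *)
definition orthonormal_mat :: "real mat \<Rightarrow> bool" where
  "orthonormal_mat Q \<longleftrightarrow> transpose_mat Q * Q = 1\<^sub>m (dim_col Q)"

(* The matrix [M, v]. *)
definition append_col :: "real mat \<Rightarrow> real vec \<Rightarrow> real mat" where
  "append_col M v = mat_of_cols (dim_row M) (cols M @ [v])"

(* The rank-one matrix u v^T. *)
definition outer_prod :: "real vec \<Rightarrow> real vec \<Rightarrow> real mat" where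
  "outer_prod u v = mat_of_cols (dim_vec u) [u] * mat_of_rows (dim_vec v) [v]"

(* The values q 1, ..., q k are the first k vectors generated by the Lanczos process
   for A without breakdown; q j for j > k and alpha j, beta j for j \<ge> k are unconstrained.
   The convention beta_0 q_0 = 0 starts the three-term recurrence. The sign of beta j
   is not fixed. *)
definition lanczos_process ::
  "nat \<Rightarrow> real mat \<Rightarrow> nat \<Rightarrow> (nat \<Rightarrow> real vec) \<Rightarrow> (nat \<Rightarrow> real) \<Rightarrow> (nat \<Rightarrow> real) \<Rightarrow> bool" where
  "lanczos_process n A k q \<alpha> \<beta> \<longleftrightarrow>
     q 1 \<in> carrier_vec n \<and> euclid_norm (q 1) = 1 \<and>
     \<beta> 0 \<cdot>\<^sub>v q 0 = 0\<^sub>v n \<and>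
     (\<forall>j. 1 \<le> j \<and> j < k \<longrightarrow>
        \<alpha> j = q j \<bullet> (A *\<^sub>v q j) \<and>
        \<beta> j \<noteq> 0 \<and>
        q (j + 1) = inverse (\<beta> j) \<cdot>\<^sub>v
          (A *\<^sub>v q j - \<alpha> j \<cdot>\<^sub>v q j - \<beta> (j - 1) \<cdot>\<^sub>v q (j - 1)) \<and>
        euclid_norm (q (j + 1)) = 1)"

(* Krylov-like decomposition A Q = Q T + q_{i+1} b^T + F of an n x n matrix A, where
   Q is n x m and q_{i+1}, i \<ge> m, comes from the Lanczos process. *)
definition krylov_like_decomposition ::
  "nat \<Rightarrow> nat \<Rightarrow> nat \<Rightarrow> real mat \<Rightarrow> real mat \<Rightarrow> real mat \<Rightarrow> real vec \<Rightarrow> real mat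
    \<Rightarrow> (nat \<Rightarrow> real vec) \<Rightarrow> (nat \<Rightarrow> real) \<Rightarrow> (nat \<Rightarrow> real) \<Rightarrow> bool" where
  "krylov_like_decomposition n m i A Q T b F q \<alpha> \<beta> \<longleftrightarrow>
     Q \<in> carrier_mat n m \<and> T \<in> carrier_mat m m \<and> F \<in> carrier_mat n m \<and> b \<in> carrier_vec m \<and>
     m \<le> i \<and> lanczos_process n A (i + 1) q \<alpha> \<beta> \<and>
     A * Q = Q * T + outer_prod (q (i + 1)) b + F \<and>
     transpose_mat (append_col Q (q (i + 1))) * F = 0\<^sub>m (m + 1) m \<and>
     orthonormal_mat (append_col Q (q (i + 1))) \<and>
     symmetric_mat T"

end

theory Submission
  imports Defs
begin

text \<open>
  Transposing the decomposition and using that \<open>q\<^sub>i\<^sub>+\<^sub>1\<close> is orthogonal to the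
  columns of \<open>Q\<^sub>m\<close> and of \<open>F\<^sub>m\<close> gives \<open>Q\<^sub>m\<^sup>T A q\<^sub>i\<^sub>+\<^sub>1 = b\<^sub>m\<close>. The part of
  \<open>A q\<^sub>i\<^sub>+\<^sub>1\<close> removed by the projection is thus \<open>Q\<^sub>m b\<^sub>m\<close> plus a multiple of \<open>q\<^sub>i\<^sub>+\<^sub>1\<close> without
  compression and \<open>Q\<^sub>m V V\<^sup>T b\<^sub>m\<close> plus the same multiple with it; as \<open>V V\<^sup>T b\<^sub>m = b\<^sub>m\<close>, both new
  vectors normalize the same vector.
\<close>

lemma append_col_carrier:
  "M \<in> carrier_mat n k \<Longrightarrow> append_col M v \<in> carrier_mat n (k + 1)"
  unfolding append_col_def by auto

lemma append_col_index:
  assumes "M \<in> carrier_mat n k" "v \<in> carrier_vec n" "r < n" "j \<le> k"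
  shows "append_col M v $$ (r, j) = (if j < k then M $$ (r, j) else v $ r)"
  using assms unfolding append_col_def
  by (auto simp: mat_of_cols_def nth_append)

lemma col_append_col:
  assumes "M \<in> carrier_mat n k" "v \<in> carrier_vec n" "j \<le> k"
  shows "col (append_col M v) j = (if j < k then col M j else v)"
  using append_col_carrier[OF assms(1), of v] assms
  by (intro eq_vecI) (auto simp: append_col_index)

lemma append_col_mult_vec:
  assumes "M \<in> carrier_mat n k" "v \<in> carrier_vec n" "y \<in> carrier_vec (k + 1)"
  shows "append_col M v *\<^sub>v y = M *\<^sub>v vec k (($) y) + (y $ k) \<cdot>\<^sub>v v"
  using append_col_carrier[OF assms(1), of v] assms
  by (intro eq_vecI) (auto simp: scalar_prod_def append_col_index mult.commute)

text \<open>With X = [M, v], the block product X X^T is M M^T + v v^T. Keeping the two summands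
  apart pays off because compression replaces only \<open>M\<close>, so just the first summand has
  to be compared later.\<close>

lemma append_col_projection:
  assumes M: "M \<in> carrier_mat n k" and v: "v \<in> carrier_vec n" and x: "x \<in> carrier_vec n"
  shows "(append_col M v * transpose_mat (append_col M v)) *\<^sub>v x =
    M *\<^sub>v (transpose_mat M *\<^sub>v x) + (v \<bullet> x) \<cdot>\<^sub>v v"
proof -
  let ?X = "append_col M v"
  let ?y = "transpose_mat ?X *\<^sub>v x"
  have X: "?X \<in> carrier_mat n (k + 1)" by (rule append_col_carrier[OF M])
  have y: "?y \<in> carrier_vec (k + 1)"
    using X x by (intro mult_mat_vec_carrier[of _ _ n]) auto
  have yj: "?y $ j = (if j < k then col M j else v) \<bullet> x" if "j \<le> k" for j
    using X that by (simp add: col_append_col[OF M v])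
  have "vec k (($) ?y) = transpose_mat M *\<^sub>v x"
    using M by (intro eq_vecI) (auto simp: yj)
  moreover have "(?X * transpose_mat ?X) *\<^sub>v x = ?X *\<^sub>v ?y"
    using X x by (intro assoc_mult_mat_vec) auto
  ultimately show ?thesis
    by (simp add: append_col_mult_vec[OF M v y] yj)
qed

text \<open>Row \<open>k\<close> of the vanishing product, its last one, holds the inner products of
  \<open>v\<close> with the columns of \<open>F\<close>. This is what removes the \<open>F\<close>
  term from the transposed decomposition.\<close>

lemma transpose_append_col_mult_zero:
  assumes M: "M \<in> carrier_mat n k" and v: "v \<in> carrier_vec n" and F: "F \<in> carrier_mat n p"
    and "transpose_mat (append_col M v) * F = 0\<^sub>m (k + 1) p"
  shows "transpose_mat F *\<^sub>v v = 0\<^sub>v p"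
proof (intro eq_vecI)
  fix j assume "j < dim_vec (0\<^sub>v p :: real vec)"
  then have j: "j < p" by simp
  have "v \<bullet> col F j = (transpose_mat (append_col M v) * F) $$ (k, j)"
    using append_col_carrier[OF M, of v] F j by (simp add: col_append_col[OF M v])
  also have "\<dots> = 0" using assms(4) j by simp
  finally show "(transpose_mat F *\<^sub>v v) $ j = 0\<^sub>v p $ j"
    using F v j comm_scalar_prod[of v n "col F j"] by auto
qed (use F in auto)

lemma orthonormal_append_col:
  assumes M: "M \<in> carrier_mat n k" and v: "v \<in> carrier_vec n"
    and "orthonormal_mat (append_col M v)"
  shows "transpose_mat M *\<^sub>v v = 0\<^sub>v k" "v \<bullet> v = 1"
proof -
  let ?X = "append_col M v"
  have X: "?X \<in> carrier_mat n (k + 1)" by (rule append_col_carrier[OF M])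
  have orth: "transpose_mat ?X * ?X = 1\<^sub>m (k + 1)"
    using assms(3) X unfolding orthonormal_mat_def by auto
  have inner: "col ?X a \<bullet> col ?X c = (if a = c then 1 else 0)" if "a \<le> k" "c \<le> k" for a c
  proof -
    have "col ?X a \<bullet> col ?X c = (transpose_mat ?X * ?X) $$ (a, c)"
      using X that by simp
    then show ?thesis using orth that by simp
  qed
  show "v \<bullet> v = 1" using inner[of k k] by (simp add: col_append_col[OF M v])
  show "transpose_mat M *\<^sub>v v = 0\<^sub>v k"
  proof (intro eq_vecI)
    fix j assume "j < dim_vec (0\<^sub>v k :: real vec)"
    then have "j < k" by simp
    with inner[of j k] show "(transpose_mat M *\<^sub>v v) $ j = 0\<^sub>v k $ j"
      using M by (simp add: col_append_col[OF M v])
  qed (use M in auto)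
qed

lemma transpose_outer_prod_mult_vec:
  assumes "u \<in> carrier_vec n" "b \<in> carrier_vec m" "x \<in> carrier_vec n"
  shows "transpose_mat (outer_prod u b) *\<^sub>v x = (u \<bullet> x) \<cdot>\<^sub>v b"
  using assms unfolding outer_prod_def
  by (intro eq_vecI)
    (auto simp: scalar_prod_def mat_of_cols_def mat_of_rows_def sum_distrib_right
      intro!: sum.cong)

text \<open>\<open>lanczos_process\<close> places only \<open>q 1\<close> in
  \<open>carrier_vec n\<close> explicitly; the dimension of the later vectors has to be recovered
  from the recurrence.\<close>

lemma lanczos_process_carrier:
  assumes L: "lanczos_process n A k q \<alpha> \<beta>" and "1 \<le> j" "j \<le> k"
  shows "q j \<in> carrier_vec n"
proof -
  have "j \<le> k \<Longrightarrow> dim_vec (q j) = n"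
  proof (induction j rule: less_induct)
    case (less j)
    \<comment> \<open>A difference of vectors takes the dimension of its right operand, so
      \<open>q (p + 2)\<close> inherits its dimension from \<open>q p\<close>. The induction thus
      goes down by two and needs both base cases 0 and 1.\<close>
    consider "j = 0" | "j = 1" | "2 \<le> j" by linarith
    then show ?case
    proof cases
      case 1
      \<comment> \<open>Scaling preserves the dimension even when the factor is zero, so the
        starting convention determines the dimension of \<open>q 0\<close>.\<close>
      have "dim_vec (\<beta> 0 \<cdot>\<^sub>v q 0) = n" using L unfolding lanczos_process_def by simp
      then show ?thesis using 1 by simp
    next
      case 2
      then show ?thesis using L unfolding lanczos_process_def by auto
    next
      case 3
      then obtain p where j: "j = p + 2" by (metis le_add_diff_inverse2)
      then have "q j = inverse (\<beta> (p + 1)) \<cdot>\<^sub>v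
          (A *\<^sub>v q (p + 1) - \<alpha> (p + 1) \<cdot>\<^sub>v q (p + 1) - \<beta> p \<cdot>\<^sub>v q p)"
        using L less.prems unfolding lanczos_process_def by (auto dest: spec[of _ "p + 1"])
      then show ?thesis using j less by simp
    qed
  qed
  then show ?thesis using assms(3) by (intro carrier_vecI) auto
qed

lemma euclid_norm_smult: "euclid_norm (c \<cdot>\<^sub>v v) = \<bar>c\<bar> * euclid_norm v"
  unfolding euclid_norm_def by (simp add: real_sqrt_mult flip: mult.assoc)

text \<open>Unit norm forces both \<bar>c\<bar> and \<bar>d\<bar> to equal the norm of
  \<open>w\<close>, and reals of equal absolute value differ at most by a sign.\<close>

lemma normalizations_agree_up_to_sign:
  fixes c d :: real
  assumes "c \<noteq> 0" "d \<noteq> 0" "euclid_norm (inverse c \<cdot>\<^sub>v w) = 1" "euclid_norm (inverse d \<cdot>\<^sub>v w) = 1"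
  shows "\<exists>\<sigma>\<in>{1, -1}. d = \<sigma> * c \<and> inverse d \<cdot>\<^sub>v w = \<sigma> \<cdot>\<^sub>v (inverse c \<cdot>\<^sub>v w)"
proof -
  have "\<bar>c\<bar> = \<bar>d\<bar>"
    using assms by (simp add: euclid_norm_smult field_simps)
  then consider "d = c" | "d = - c" by linarith
  then show ?thesis by cases (auto simp: smult_smult_assoc)
qed

lemma krylov_like_decomposition_coefficients:
  assumes A: "A \<in> carrier_mat n n" "symmetric_mat A"
    and dec: "krylov_like_decomposition n m i A Q T b F q \<alpha> \<beta>"
  shows "transpose_mat Q *\<^sub>v (A *\<^sub>v q (i + 1)) = b"
proof -
  let ?v = "q (i + 1)"
  have Q: "Q \<in> carrier_mat n m" and T: "T \<in> carrier_mat m m" and F: "F \<in> carrier_mat n m"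
    and b: "b \<in> carrier_vec m"
    and AQ: "A * Q = Q * T + outer_prod ?v b + F"
    and QF: "transpose_mat (append_col Q ?v) * F = 0\<^sub>m (m + 1) m"
    and orth: "orthonormal_mat (append_col Q ?v)"
    and v: "?v \<in> carrier_vec n"
    using dec lanczos_process_carrier[of n A "i + 1" q \<alpha> \<beta> "i + 1"]
    unfolding krylov_like_decomposition_def by auto
  have O: "outer_prod ?v b \<in> carrier_mat n m"
    using v b unfolding outer_prod_def by auto
  have QT: "transpose_mat (Q * T) *\<^sub>v ?v = 0\<^sub>v m"
  proof -
    have "transpose_mat (Q * T) *\<^sub>v ?v = transpose_mat T *\<^sub>v (transpose_mat Q *\<^sub>v ?v)"
      using Q T v by (simp add: transpose_mult[OF Q T] assoc_mult_mat_vec[of _ m m _ n])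
    also have "transpose_mat Q *\<^sub>v ?v = 0\<^sub>v m" by (rule orthonormal_append_col(1)[OF Q v orth])
    finally show ?thesis using T by (auto intro!: eq_vecI)
  qed
  \<comment> \<open>Symmetry of \<open>A\<close> turns the left side into the transpose of
    \<open>A * Q\<close> applied to \<open>?v\<close>, where the decomposition can be
    substituted.\<close>
  have "transpose_mat Q *\<^sub>v (A *\<^sub>v ?v) = (transpose_mat Q * transpose_mat A) *\<^sub>v ?v"
    using A Q v unfolding symmetric_mat_def
    by (simp add: assoc_mult_mat_vec[of _ m n _ n])
  also have "\<dots> = transpose_mat (A * Q) *\<^sub>v ?v" by (simp add: transpose_mult[OF A(1) Q])
  also have "\<dots> = transpose_mat (Q * T) *\<^sub>v ?v + transpose_mat (outer_prod ?v b) *\<^sub>v ?v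
      + transpose_mat F *\<^sub>v ?v"
    unfolding AQ using Q T F O v
    by (simp add: transpose_add[of _ n m] add_mult_distrib_mat_vec[of _ m n])
  \<comment> \<open>The outer product contributes \<open>b\<close> scaled by the inner product of
    \<open>?v\<close> with itself, which is 1; the other two terms vanish.\<close>
  also have "\<dots> = b"
    using b QT transpose_outer_prod_mult_vec[OF v b v] orthonormal_append_col(2)[OF Q v orth]
      transpose_append_col_mult_zero[OF Q v F QF]
    by simp
  finally show ?thesis .
qed

theorem proposition2p2:
  fixes n m l i :: nat
    and A Q T F V Q1 Qt Qt1 :: "real mat"
    and b qt1 qt2 :: "real vec"
    and q :: "nat \<Rightarrow> real vec"
    and \<alpha> \<beta> :: "nat \<Rightarrow> real"
    and \<beta>t :: real
  assumes A: "A \<in> carrier_mat n n" "symmetric_mat A"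
    and dec: "krylov_like_decomposition n m i A Q T b F q \<alpha> \<beta>"
    and Q1: "Q1 = append_col Q (q (i + 1))"
    and V: "V \<in> carrier_mat m l" "l < m" "orthonormal_mat V"
    and Qt: "Qt = Q * V"
    and qt1: "qt1 = q (i + 1)"
    and Qt1: "Qt1 = append_col Qt (q (i + 1))"
    and nonzero: "\<beta> (i + 1) \<noteq> 0" "\<beta>t \<noteq> 0"
    and q2: "q (i + 2) = inverse (\<beta> (i + 1)) \<cdot>\<^sub>v
               ((1\<^sub>m n - Q1 * transpose_mat Q1) *\<^sub>v (A *\<^sub>v q (i + 1)))"
    and qt2: "qt2 = inverse \<beta>t \<cdot>\<^sub>v
               ((1\<^sub>m n - Qt1 * transpose_mat Qt1) *\<^sub>v (A *\<^sub>v qt1))"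
    and unit: "euclid_norm (q (i + 2)) = 1" "euclid_norm qt2 = 1"
    and Vb: "(V * transpose_mat V) *\<^sub>v b = b"
  shows "\<exists>\<sigma>\<in>{1, -1}. \<beta>t = \<sigma> * \<beta> (i + 1) \<and> qt2 = \<sigma> \<cdot>\<^sub>v q (i + 2)"
proof -
  let ?v = "q (i + 1)"
  let ?u = "A *\<^sub>v ?v"
  have Q: "Q \<in> carrier_mat n m" and v: "?v \<in> carrier_vec n"
    using dec lanczos_process_carrier[of n A "i + 1" q \<alpha> \<beta> "i + 1"]
    unfolding krylov_like_decomposition_def by auto
  have u: "?u \<in> carrier_vec n" using A v by auto
  have QtC: "Qt \<in> carrier_mat n l" using Q V Qt by auto
  note Qu = krylov_like_decomposition_coefficients[OF A dec]
  \<comment> \<open>\<open>Qu\<close> is applied from right to left: \<open>b\<close> is expanded,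
    and both sides become the transpose of \<open>V\<close> applied to the coefficients of
    \<open>?u\<close> along \<open>Q\<close>.\<close>
  have "transpose_mat Qt *\<^sub>v ?u = transpose_mat V *\<^sub>v b"
    using Q V(1) u
    by (simp add: Qt transpose_mult[OF Q V(1)] assoc_mult_mat_vec[of _ l m _ n] flip: Qu)
  moreover have b: "b \<in> carrier_vec m"
    using dec unfolding krylov_like_decomposition_def by auto
  ultimately have "Qt *\<^sub>v (transpose_mat Qt *\<^sub>v ?u) = Q *\<^sub>v (V *\<^sub>v (transpose_mat V *\<^sub>v b))"
    using Q V(1) by (simp add: Qt assoc_mult_mat_vec[of _ n m _ l])
  \<comment> \<open>Here the compression hypothesis enters: \<open>b\<close> lies in the range of
    \<open>V\<close>, so projecting onto that range loses nothing.\<close>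
  also have "V *\<^sub>v (transpose_mat V *\<^sub>v b) = b"
    using Vb V(1) b by (simp add: assoc_mult_mat_vec[of _ m l _ m])
  finally have "Qt *\<^sub>v (transpose_mat Qt *\<^sub>v ?u) = Q *\<^sub>v (transpose_mat Q *\<^sub>v ?u)"
    by (simp flip: Qu)
  \<comment> \<open>Both projections share the summand along \<open>?v\<close>, so equality of the
    first summands suffices.\<close>
  then have proj: "(Qt1 * transpose_mat Qt1) *\<^sub>v ?u = (Q1 * transpose_mat Q1) *\<^sub>v ?u"
    unfolding Qt1 Q1 append_col_projection[OF QtC v u] append_col_projection[OF Q v u]
    by (rule arg_cong)
  have "(1\<^sub>m n - Qt1 * transpose_mat Qt1) *\<^sub>v ?u = (1\<^sub>m n - Q1 * transpose_mat Q1) *\<^sub>v ?u"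
    using append_col_carrier[OF QtC, of ?v] append_col_carrier[OF Q, of ?v] u proj
    by (simp add: Q1 Qt1 minus_mult_distrib_mat_vec[of _ n n])
  then have qt2': "qt2 = inverse \<beta>t \<cdot>\<^sub>v ((1\<^sub>m n - Q1 * transpose_mat Q1) *\<^sub>v ?u)"
    using qt2 qt1 by simp
  show ?thesis
    unfolding q2 qt2'
    by (rule normalizations_agree_up_to_sign[OF nonzero unit[unfolded q2 qt2']])
qed

end
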